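(* Let $G$ be a finite group containing a normal subgroup $H$ such that $G/H$ is cyclic. Let $Ht$ be a coset of $H$ in $G$ which generates the quotient group $G/H$, and let $Hx$ be any coset of $H$ in $G$. Then there is a matching (a bijection) between the set of non-split conjugacy classes of $G$ contained in $Hx$ and the set of conjugacy classes of $G$ contained in $Ht$, such that if $C$ is matched with $D$, then $C \sim D$.
   Context: All conjugacy classes are conjugacy classes of $G$. Since $G/H$ is abelian, each conjugacy class of $G$ is entirely contained in a single coset of $H$. For $g \in G$ and a subgroup $K \le G$, write $g^K = \{k^{-1} g k : k \in K\}$. A conjugacy class $g^G$ of $G$ is called non-split (with respect to $H$) if $g^G = g^H$, and split otherwise. For conjugacy classes $C, D$ of $G$, write $C \sim D$ (and say that $C$ commutes with $D$) if there exist elements $c \in C$ and $d \in D$ such that $cd = dc$. *)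

theory Defs
  imports "HOL-Algebra.Elementary_Groups"
begin

definition conjugates_by :: "('a, 'b) monoid_scheme \<Rightarrow> 'a set \<Rightarrow> 'a \<Rightarrow> 'a set"
  where "conjugates_by G K g = {inv\<^bsub>G\<^esub> k \<otimes>\<^bsub>G\<^esub> g \<otimes>\<^bsub>G\<^esub> k | k. k \<in> K}"

definition conjugacy_classes :: "('a, 'b) monoid_scheme \<Rightarrow> 'a set set"
  where "conjugacy_classes G = {conjugates_by G (carrier G) g | g. g \<in> carrier G}"

text \<open>For normal \<open>H\<close> the choice of representative does not matter; see
  \<open>non_split_conjugates_by_iff\<close> below.\<close>

definition non_split :: "('a, 'b) monoid_scheme \<Rightarrow> 'a set \<Rightarrow> 'a set \<Rightarrow> bool"
  where "non_split G H C \<longleftrightarrow>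
    (\<exists>g \<in> carrier G. C = conjugates_by G (carrier G) g \<and>
       conjugates_by G (carrier G) g = conjugates_by G H g)"

definition classes_commute :: "('a, 'b) monoid_scheme \<Rightarrow> 'a set \<Rightarrow> 'a set \<Rightarrow> bool"
  where "classes_commute G C D \<longleftrightarrow> (\<exists>c \<in> C. \<exists>d \<in> D. c \<otimes>\<^bsub>G\<^esub> d = d \<otimes>\<^bsub>G\<^esub> c)"

lemma conjugates_byI:
  "k \<in> K \<Longrightarrow> inv\<^bsub>G\<^esub> k \<otimes>\<^bsub>G\<^esub> g \<otimes>\<^bsub>G\<^esub> k \<in> conjugates_by G K g"
  by (auto simp: conjugates_by_def)

lemma conjugates_byE:
  assumes "y \<in> conjugates_by G K g"
  obtains k where "k \<in> K" "y = inv\<^bsub>G\<^esub> k \<otimes>\<^bsub>G\<^esub> g \<otimes>\<^bsub>G\<^esub> k"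
  using assms by (auto simp: conjugates_by_def)

lemma (in group) conjugate_in_conjugates_by:
  assumes "H \<lhd> G" "g \<in> carrier G" "a \<in> carrier G"
    and sub: "conjugates_by G (carrier G) g \<subseteq> conjugates_by G H g"
  shows "conjugates_by G (carrier G) (inv a \<otimes> g \<otimes> a) = conjugates_by G H (inv a \<otimes> g \<otimes> a)"
proof -
  interpret normal H G by fact
  let ?b = "inv a \<otimes> g \<otimes> a"
  have b: "?b \<in> carrier G" using assms by simp
  have "y \<in> conjugates_by G H ?b" if yb: "y \<in> conjugates_by G (carrier G) ?b" for y
  proof -
    obtain k where k: "k \<in> carrier G" and y: "y = inv k \<otimes> ?b \<otimes> k"
      using yb by (rule conjugates_byE)
    have "inv (a \<otimes> k \<otimes> inv a) \<otimes> g \<otimes> (a \<otimes> k \<otimes> inv a) \<in> conjugates_by G (carrier G) g"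
      using k assms(3) by (intro conjugates_byI) simp
    with sub have "inv (a \<otimes> k \<otimes> inv a) \<otimes> g \<otimes> (a \<otimes> k \<otimes> inv a) \<in> conjugates_by G H g"
      by (rule subsetD)
    then obtain h where h: "h \<in> H"
      and e: "inv (a \<otimes> k \<otimes> inv a) \<otimes> g \<otimes> (a \<otimes> k \<otimes> inv a) = inv h \<otimes> g \<otimes> h"
      by (rule conjugates_byE)
    have hc: "h \<in> carrier G" using h by (rule mem_carrier)
    have r: "a \<otimes> (inv a \<otimes> z) = z" "inv a \<otimes> (a \<otimes> z) = z" if "z \<in> carrier G" for z
      using that assms(3) by (metis m_assoc inv_closed r_inv l_inv l_one)+
    have "y = inv a \<otimes> (inv (a \<otimes> k \<otimes> inv a) \<otimes> g \<otimes> (a \<otimes> k \<otimes> inv a)) \<otimes> a"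
      unfolding y using k assms(2,3) by (simp add: inv_mult_group m_assoc r)
    also have "\<dots> = inv a \<otimes> (inv h \<otimes> g \<otimes> h) \<otimes> a"
      by (simp only: e)
    also have "\<dots> = inv (inv a \<otimes> h \<otimes> a) \<otimes> ?b \<otimes> (inv a \<otimes> h \<otimes> a)"
      using hc assms(2,3) by (simp add: inv_mult_group m_assoc r)
    finally have "y = inv (inv a \<otimes> h \<otimes> a) \<otimes> ?b \<otimes> (inv a \<otimes> h \<otimes> a)" .
    then show ?thesis
      by (simp only:) (rule conjugates_byI[OF inv_op_closed1[OF assms(3) h]])
  qed
  moreover have "conjugates_by G H ?b \<subseteq> conjugates_by G (carrier G) ?b"
    using mem_carrier by (intro subsetI) (elim conjugates_byE, simp add: conjugates_byI)
  ultimately show ?thesis by blast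
qed

lemma (in group) non_split_conjugates_by_iff:
  assumes "H \<lhd> G" "g \<in> carrier G"
  shows "non_split G H (conjugates_by G (carrier G) g) \<longleftrightarrow>
    conjugates_by G (carrier G) g = conjugates_by G H g"
proof
  assume "non_split G H (conjugates_by G (carrier G) g)"
  then obtain g' where g': "g' \<in> carrier G"
    and eq: "conjugates_by G (carrier G) g = conjugates_by G (carrier G) g'"
    and ns: "conjugates_by G (carrier G) g' = conjugates_by G H g'"
    unfolding non_split_def by blast
  have "inv \<one> \<otimes> g \<otimes> \<one> \<in> conjugates_by G (carrier G) g"
    by (rule conjugates_byI) simp
  then have "g \<in> conjugates_by G (carrier G) g'"
    using assms(2) eq by simp
  then obtain a where "a \<in> carrier G" "g = inv a \<otimes> g' \<otimes> a"
    by (rule conjugates_byE)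
  then show "conjugates_by G (carrier G) g = conjugates_by G H g"
    using conjugate_in_conjugates_by[OF assms(1) g', of a] ns by simp
qed (use assms in \<open>auto simp: non_split_def\<close>)

end

theory Submission
  imports Defs
begin

text \<open>Make the two sets of classes into a matrix whose entry at \<open>(C, D)\<close> is the number of commuting
  pairs in \<open>C \<times> D\<close>. All its row sums and all its column sums turn out to be \<open>card H\<close>, so up to scaling
  it is doubly stochastic. Such a matrix is square, and by Hall's marriage theorem it has a
  permutation supported on its nonzero entries, which is the matching wanted
  (\<open>bij_betw_of_constant_marginals\<close>).

  The constant sums rest on two facts. If \<open>g\<^sup>G = g\<^sup>H\<close>, then the centralizer of \<open>g\<close> meets every
  coset \<open>Hy\<close>, and hence in as many elements as it meets \<open>H\<close>; by orbit-stabilizer this number is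
  \<open>card H / card g\<^sup>G\<close>. Summing over the elements of a non-split class \<open>C\<close>, exactly \<open>card H\<close> pairs in
  \<open>C \<times> Hy\<close> commute (\<open>commuting_pairs_class_coset\<close>). Conversely, an element that commutes with some
  element of the generating coset \<open>Ht\<close> has a non-split class
  (\<open>non_split_if_centralizer_meets_generator\<close>). So every class in \<open>Ht\<close> is non-split, and the
  columns lose nothing when the split classes of \<open>Hx\<close> are left out: no element of a split class
  commutes with anything in \<open>Ht\<close>. The classes contained in \<open>Ht\<close> fill up \<open>Ht\<close>, since each lies in a
  single coset, and those counted in \<open>Hx\<close> fill up its non-split part, so a row or column sum is the count of commuting pairs between one
  non-split class and a whole coset.\<close>

section \<open>Matchings from constant marginals\<close>

text \<open>Induction on \<open>A\<close>. A nonempty proper subset \<open>X\<close> on which the condition is an equality uses up its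
  neighbourhood completely; the rest of \<open>A\<close> satisfies the condition with that neighbourhood deleted,
  because any deficient \<open>Y\<close> would make \<open>Y \<union> X\<close> deficient. If there is no such \<open>X\<close>, there is slack
  to match one element arbitrarily and delete its partner.\<close>

theorem hall_marriage:
  fixes N :: "'a \<Rightarrow> 'b set"
  assumes "finite A" and "\<And>a. a \<in> A \<Longrightarrow> finite (N a)"
    and "\<And>X. X \<subseteq> A \<Longrightarrow> card X \<le> card (\<Union>(N ` X))"
  shows "\<exists>f. inj_on f A \<and> (\<forall>a \<in> A. f a \<in> N a)"
  using assms
proof (induction A arbitrary: N rule: finite_psubset_induct)
  case (psubset A)
  note fin = psubset.prems(1) and hall = psubset.prems(2)
  consider (empty) "A = {}"
    | (tight) X where "X \<subset> A" "X \<noteq> {}" "card (\<Union>(N ` X)) = card X"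
    | (slack) "A \<noteq> {}" "\<And>X. X \<subset> A \<Longrightarrow> X \<noteq> {} \<Longrightarrow> card X < card (\<Union>(N ` X))"
    using hall by (metis order_le_less psubset_imp_subset)
  then show ?case
  proof cases
    case empty
    then show ?thesis by simp
  next
    case tight
    let ?U = "\<Union>(N ` X)"
    have finX: "finite X" using tight(1) psubset.hyps(1) by (meson finite_subset psubset_imp_subset)
    have finU: "finite ?U" using finX fin tight(1) by auto
    have "\<exists>f. inj_on f X \<and> (\<forall>a \<in> X. f a \<in> N a)"
      using tight(1) fin hall by (intro psubset.IH) auto
    then obtain f where f: "inj_on f X" "\<forall>a \<in> X. f a \<in> N a" by blast
    have "\<exists>g. inj_on g (A - X) \<and> (\<forall>a \<in> A - X. g a \<in> N a - ?U)"
    proof (rule psubset.IH)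
      show "A - X \<subset> A" using tight by blast
      show "finite (N a - ?U)" if "a \<in> A - X" for a using that fin by simp
      fix Y assume Y: "Y \<subseteq> A - X"
      have finY: "finite Y" using Y psubset.hyps(1) by (meson finite_Diff finite_subset)
      let ?V = "\<Union>a\<in>Y. N a - ?U"
      have finV: "finite ?V" using finY fin Y by auto
      have "card Y + card X = card (Y \<union> X)"
        using finX finY Y by (subst card_Un_disjoint) auto
      also have "\<dots> \<le> card (\<Union>(N ` (Y \<union> X)))"
        using Y tight(1) by (intro hall) auto
      also have "\<Union>(N ` (Y \<union> X)) = ?V \<union> ?U" by auto
      also have "card (?V \<union> ?U) = card ?V + card ?U"
        using finU finV by (intro card_Un_disjoint) auto
      finally show "card Y \<le> card ?V" using tight(3) by simp
    qed
    then obtain g where g: "inj_on g (A - X)" "\<forall>a \<in> A - X. g a \<in> N a - ?U" by blast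
    let ?h = "\<lambda>a. if a \<in> X then f a else g a"
    have "inj_on ?h A"
    proof (rule inj_onI)
      fix a b assume ab: "a \<in> A" "b \<in> A" "?h a = ?h b"
      have no: False if "u \<in> X" "v \<in> A - X" "f u = g v" for u v
        using f(2) g(2) that by (metis DiffD2 UN_I)
      show "a = b"
      proof (cases "a \<in> X"; cases "b \<in> X")
        assume "a \<in> X" "b \<in> X"
        then show ?thesis using ab f(1) by (simp add: inj_on_eq_iff)
      next
        assume "a \<notin> X" "b \<notin> X"
        then show ?thesis using ab g(1) by (simp add: inj_on_eq_iff)
      qed (use ab no[of a b] no[of b a] in auto)
    qed
    moreover have "\<forall>a \<in> A. ?h a \<in> N a" using f g by simp
    ultimately show ?thesis by blast
  next
    case slack
    then obtain a where a: "a \<in> A" by blast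
    have "card {a} \<le> card (\<Union>(N ` {a}))" using a by (intro hall) simp
    then have "N a \<noteq> {}" by auto
    then obtain b where b: "b \<in> N a" by blast
    have "\<exists>g. inj_on g (A - {a}) \<and> (\<forall>c \<in> A - {a}. g c \<in> N c - {b})"
    proof (rule psubset.IH)
      show "A - {a} \<subset> A" using a by blast
      show "finite (N c - {b})" if "c \<in> A - {a}" for c using that fin by simp
      fix Y assume Y: "Y \<subseteq> A - {a}"
      show "card Y \<le> card (\<Union>c\<in>Y. N c - {b})"
      proof (cases "Y = {}")
        case False
        then have "card Y < card (\<Union>(N ` Y))" using Y a by (intro slack(2)) auto
        moreover have "(\<Union>c\<in>Y. N c - {b}) = \<Union>(N ` Y) - {b}" by auto
        moreover have "card (\<Union>(N ` Y)) - 1 \<le> card (\<Union>(N ` Y) - {b})"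
          by (simp add: card_Diff_singleton_if)
        ultimately show ?thesis by simp
      qed simp
    qed
    then obtain g where g: "inj_on g (A - {a})" "\<forall>c \<in> A - {a}. g c \<in> N c - {b}" by blast
    let ?h = "g(a := b)"
    have "inj_on ?h A"
    proof (rule inj_onI)
      fix u v assume "u \<in> A" "v \<in> A" "?h u = ?h v"
      then show "u = v" using g by (auto simp: inj_on_def split: if_splits)
    qed
    moreover have "\<forall>c \<in> A. ?h c \<in> N c" using b g by auto
    ultimately show ?thesis by blast
  qed
qed

text \<open>The \<open>X\<close>-rows have total weight \<open>card X * n\<close>, all of it in the columns \<open>N(X)\<close> of their support,
  whose total weight is \<open>card N(X) * n\<close>; this is Hall's condition. Adding all entries in both orders
  gives \<open>card A = card B\<close>, so an injective choice is onto.\<close>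

lemma bij_betw_of_constant_marginals:
  fixes w :: "'a \<Rightarrow> 'b \<Rightarrow> nat"
  assumes fin: "finite A" "finite B" and "n > 0"
    and row: "\<And>a. a \<in> A \<Longrightarrow> (\<Sum>b\<in>B. w a b) = n"
    and col: "\<And>b. b \<in> B \<Longrightarrow> (\<Sum>a\<in>A. w a b) = n"
  shows "\<exists>f. bij_betw f A B \<and> (\<forall>a \<in> A. w a (f a) > 0)"
proof -
  define N where "N a = {b \<in> B. w a b > 0}" for a
  have "\<exists>f. inj_on f A \<and> (\<forall>a \<in> A. f a \<in> N a)"
  proof (rule hall_marriage)
    fix X assume X: "X \<subseteq> A"
    let ?U = "\<Union>(N ` X)"
    have UB: "?U \<subseteq> B" by (auto simp: N_def)
    have "card X * n = (\<Sum>a\<in>X. \<Sum>b\<in>B. w a b)"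
      using X row by (simp add: subset_iff)
    also have "\<dots> = (\<Sum>a\<in>X. \<Sum>b\<in>?U. w a b)"
      using fin(2) UB by (intro sum.cong refl sum.mono_neutral_right) (auto simp: N_def)
    also have "\<dots> \<le> (\<Sum>a\<in>A. \<Sum>b\<in>?U. w a b)"
      using fin(1) X by (intro sum_mono2) auto
    also have "\<dots> = (\<Sum>b\<in>?U. \<Sum>a\<in>A. w a b)" by (rule sum.swap)
    also have "\<dots> = card ?U * n"
      using UB col by (simp add: subset_iff)
    finally show "card X \<le> card ?U" using \<open>n > 0\<close> by simp
  qed (use fin in \<open>auto simp: N_def\<close>)
  then obtain f where f: "inj_on f A" "\<forall>a \<in> A. f a \<in> N a" by blast
  have "card A * n = (\<Sum>a\<in>A. \<Sum>b\<in>B. w a b)" using row by simp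
  also have "\<dots> = (\<Sum>b\<in>B. \<Sum>a\<in>A. w a b)" by (rule sum.swap)
  also have "\<dots> = card B * n" using col by simp
  finally have "card A = card B" using \<open>n > 0\<close> by simp
  moreover have "f ` A \<subseteq> B" using f(2) by (auto simp: N_def)
  ultimately have "bij_betw f A B"
    using f(1) fin by (simp add: bij_betw_def card_image card_subset_eq)
  then show ?thesis using f(2) by (auto simp: N_def)
qed

section \<open>Conjugacy and centralizers\<close>

context group
begin

definition centralizer :: "'a \<Rightarrow> 'a set"
  where "centralizer g = {z \<in> carrier G. z \<otimes> g = g \<otimes> z}"

lemma centralizer_closed: "z \<in> centralizer g \<Longrightarrow> z \<in> carrier G"
  by (simp add: centralizer_def)

lemma subgroup_centralizer:
  assumes g: "g \<in> carrier G"
  shows "subgroup (centralizer g) G"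
proof (rule subgroupI)
  show "centralizer g \<noteq> {}" using g by (auto simp: centralizer_def intro!: exI[of _ \<one>])
  fix a assume "a \<in> centralizer g"
  then have a: "a \<in> carrier G" "a \<otimes> g = g \<otimes> a" by (auto simp: centralizer_def)
  have "inv a \<otimes> g = inv a \<otimes> (g \<otimes> a) \<otimes> inv a" using a(1) g by (simp add: m_assoc)
  also have "\<dots> = g \<otimes> inv a" unfolding a(2)[symmetric] using a(1) g by (simp flip: m_assoc)
  finally show "inv a \<in> centralizer g" using a(1) by (simp add: centralizer_def)
  fix b assume "b \<in> centralizer g"
  then have b: "b \<in> carrier G" "b \<otimes> g = g \<otimes> b" by (auto simp: centralizer_def)
  have "a \<otimes> b \<otimes> g = a \<otimes> g \<otimes> b" using a(1) b g by (simp add: m_assoc)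
  also have "\<dots> = g \<otimes> (a \<otimes> b)" using a b(1) g by (simp add: m_assoc)
  finally show "a \<otimes> b \<in> centralizer g" using a(1) b(1) by (simp add: centralizer_def)
qed (auto simp: centralizer_def)

lemma centralizer_mult_conj:
  assumes "c \<in> centralizer g" "h \<in> carrier G" "g \<in> carrier G"
  shows "inv (c \<otimes> h) \<otimes> g \<otimes> (c \<otimes> h) = inv h \<otimes> g \<otimes> h"
proof -
  have c: "c \<in> carrier G" "g \<otimes> c = c \<otimes> g" using assms(1) by (auto simp: centralizer_def)
  have "inv (c \<otimes> h) \<otimes> g \<otimes> (c \<otimes> h) = inv h \<otimes> (inv c \<otimes> (g \<otimes> c)) \<otimes> h"
    using assms c(1) by (simp add: inv_mult_group m_assoc)
  also have "inv c \<otimes> (g \<otimes> c) = g"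
    unfolding c(2) using assms c(1) by (simp flip: m_assoc)
  finally show ?thesis .
qed

lemma conj_eq_iff_centralizer:
  assumes "g \<in> carrier G" "a \<in> carrier G" "b \<in> carrier G"
  shows "inv a \<otimes> g \<otimes> a = inv b \<otimes> g \<otimes> b \<longleftrightarrow> a \<otimes> inv b \<in> centralizer g"
proof
  assume "a \<otimes> inv b \<in> centralizer g"
  then have "inv (a \<otimes> inv b \<otimes> b) \<otimes> g \<otimes> (a \<otimes> inv b \<otimes> b) = inv b \<otimes> g \<otimes> b"
    using assms by (intro centralizer_mult_conj) auto
  then show "inv a \<otimes> g \<otimes> a = inv b \<otimes> g \<otimes> b" using assms by (simp add: m_assoc)
next
  assume e: "inv a \<otimes> g \<otimes> a = inv b \<otimes> g \<otimes> b"
  have "g \<otimes> (a \<otimes> inv b) = a \<otimes> (inv a \<otimes> g \<otimes> a) \<otimes> inv b"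
    using assms by (simp flip: m_assoc)
  also have "\<dots> = a \<otimes> inv b \<otimes> g"
    unfolding e using assms by (simp add: m_assoc)
  finally show "a \<otimes> inv b \<in> centralizer g" using assms by (simp add: centralizer_def)
qed

abbreviation conj_class :: "'a \<Rightarrow> 'a set"
  where "conj_class g \<equiv> conjugates_by G (carrier G) g"

lemma self_in_class: "g \<in> carrier G \<Longrightarrow> g \<in> conj_class g"
  using conjugates_byI[of "\<one>" "carrier G" G g] by simp

lemma class_subset: "g \<in> carrier G \<Longrightarrow> conj_class g \<subseteq> carrier G"
  by (auto elim!: conjugates_byE)

lemma class_eq:
  assumes g: "g \<in> carrier G" and y: "y \<in> conj_class g"
  shows "conj_class y = conj_class g"
proof -
  have sub: "conj_class y \<subseteq> conj_class g" if g: "g \<in> carrier G" and y: "y \<in> conj_class g" for g y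
  proof
    obtain a where a: "a \<in> carrier G" "y = inv a \<otimes> g \<otimes> a" using y by (rule conjugates_byE)
    fix z assume "z \<in> conj_class y"
    then obtain b where b: "b \<in> carrier G" "z = inv b \<otimes> y \<otimes> b" by (rule conjugates_byE)
    have "z = inv (a \<otimes> b) \<otimes> g \<otimes> (a \<otimes> b)"
      using a b g by (simp add: inv_mult_group m_assoc)
    then show "z \<in> conj_class g" using a b by (auto intro!: conjugates_byI)
  qed
  obtain a where a: "a \<in> carrier G" "y = inv a \<otimes> g \<otimes> a" using y by (rule conjugates_byE)
  have "g = inv (inv a) \<otimes> y \<otimes> inv a"
    unfolding a(2) using a(1) g by (simp add: m_assoc) (simp flip: m_assoc)
  then have "g \<in> conj_class y" using a(1) conjugates_byI[of "inv a" "carrier G" G y] by simp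
  then show ?thesis using sub[OF g y] sub[of y g] class_subset[OF g] y by blast
qed

lemma conjugacy_class_of_member:
  assumes "C \<in> conjugacy_classes G" "c \<in> C"
  shows "c \<in> carrier G" "C = conj_class c"
proof -
  obtain g where g: "g \<in> carrier G" "C = conj_class g"
    using assms(1) by (auto simp: conjugacy_classes_def)
  show "c \<in> carrier G" using class_subset[OF g(1)] g(2) assms(2) by blast
  show "C = conj_class c" using class_eq[OF g(1)] g(2) assms(2) by simp
qed

lemma conjugacy_class_nonempty:
  assumes "C \<in> conjugacy_classes G"
  obtains c where "c \<in> C"
  using assms self_in_class by (auto simp: conjugacy_classes_def)

lemma card_rcoset:
  assumes "K \<subseteq> carrier G" "a \<in> carrier G"
  shows "card (K #> a) = card K"
  using card_cosets_equal[of "K #> a" K] assms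
  by (metis bij_betw_same_card rcosetsI)

text \<open>Orbit-stabilizer: the fibres of \<open>h \<mapsto> h\<^sup>-\<^sup>1gh\<close> on \<open>H\<close> are the right cosets of \<open>H \<inter> C\<^sub>G(g)\<close>
  in \<open>H\<close>.\<close>

lemma orbit_size:
  assumes fin: "finite (carrier G)" and H: "subgroup H G" and g: "g \<in> carrier G"
  shows "card (conjugates_by G H g) * card (H \<inter> centralizer g) = card H"
proof -
  have Hc: "H \<subseteq> carrier G" using H by (rule subgroup.subset)
  have finH: "finite H" using fin Hc by (rule rev_finite_subset)
  let ?q = "\<lambda>h. inv h \<otimes> g \<otimes> h"
  have orbit: "conjugates_by G H g = ?q ` H" by (auto simp: conjugates_by_def)
  have fibre: "card {h \<in> H. ?q h = y} = card (H \<inter> centralizer g)" if "y \<in> ?q ` H" for y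
  proof -
    obtain k where k: "k \<in> H" "y = ?q k" using \<open>y \<in> ?q ` H\<close> by blast
    have kc: "k \<in> carrier G" using k Hc by blast
    have "{h \<in> H. ?q h = y} = (H \<inter> centralizer g) #> k"
    proof (intro equalityI subsetI)
      fix h assume "h \<in> {h \<in> H. ?q h = y}"
      then have h: "h \<in> H" "?q h = ?q k" using k by auto
      then have "h \<otimes> inv k \<in> H \<inter> centralizer g"
        using k g Hc H by (simp add: conj_eq_iff_centralizer subset_iff subgroup.m_closed subgroup.m_inv_closed)
      moreover have "h = (h \<otimes> inv k) \<otimes> k" using h kc Hc by (simp add: m_assoc subset_iff)
      ultimately show "h \<in> (H \<inter> centralizer g) #> k" by (auto simp: r_coset_def)
    next
      fix h assume "h \<in> (H \<inter> centralizer g) #> k"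
      then obtain z where z: "z \<in> H" "z \<in> centralizer g" "h = z \<otimes> k" by (auto simp: r_coset_def)
      then show "h \<in> {h \<in> H. ?q h = y}"
        using k kc g H by (simp add: centralizer_mult_conj subgroup.m_closed)
    qed
    moreover have "card ((H \<inter> centralizer g) #> k) = card (H \<inter> centralizer g)"
      using Hc kc by (intro card_rcoset) auto
    ultimately show ?thesis by simp
  qed
  have "card H = (\<Sum>h\<in>H. 1)" by simp
  also have "\<dots> = (\<Sum>y\<in>?q ` H. card {h \<in> H. ?q h = y})"
    using sum.image_gen[OF finH, of "\<lambda>_. 1::nat" ?q] by simp
  also have "\<dots> = card (?q ` H) * card (H \<inter> centralizer g)"
    using fibre by simp
  finally show ?thesis using orbit by simp
qed

text \<open>A nonempty intersection of \<open>K\<close> with a right coset of \<open>H\<close> is itself a right coset of \<open>H \<inter> K\<close>.\<close>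

lemma card_subgroup_inter_coset:
  assumes H: "subgroup H G" and K: "subgroup K G" and y: "y \<in> carrier G"
    and ne: "K \<inter> (H #> y) \<noteq> {}"
  shows "card (K \<inter> (H #> y)) = card (H \<inter> K)"
proof -
  have sub: "H \<subseteq> carrier G" "K \<subseteq> carrier G" using H K by (auto dest: subgroup.subset)
  obtain z where z: "z \<in> K" "z \<in> H #> y" using ne by blast
  have Hz: "H #> y = H #> z" using z(2) y H by (rule repr_independence)
  have zc: "z \<in> carrier G" using z sub by blast
  have "K \<inter> (H #> z) = (H \<inter> K) #> z"
  proof (intro equalityI subsetI)
    fix u assume "u \<in> K \<inter> (H #> z)"
    then obtain h where h: "h \<in> H" "u = h \<otimes> z" "u \<in> K" by (auto simp: r_coset_def)
    have "u \<otimes> inv z = h" using h zc sub by (simp add: m_assoc subset_iff)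
    moreover have "u \<otimes> inv z \<in> K" using h(3) z(1) K by (blast intro: subgroup.m_closed subgroup.m_inv_closed)
    ultimately have "h \<in> K" by simp
    then show "u \<in> (H \<inter> K) #> z" using h by (auto simp: r_coset_def)
  next
    fix u assume "u \<in> (H \<inter> K) #> z"
    then show "u \<in> K \<inter> (H #> z)" using z K by (auto simp: r_coset_def subgroup.m_closed)
  qed
  then show ?thesis using Hz zc sub card_rcoset[of "H \<inter> K" z] by auto
qed

section \<open>Non-split classes and the coset of a generator\<close>

lemma conj_by_subset_coset:
  assumes "H \<lhd> G" "g \<in> carrier G"
  shows "conjugates_by G H g \<subseteq> H #> g"
proof
  interpret normal H G by fact
  fix y assume "y \<in> conjugates_by G H g"
  then obtain h where h: "h \<in> H" and y: "y = inv h \<otimes> g \<otimes> h" by (rule conjugates_byE)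
  have "g \<otimes> h \<in> g <# H" using h by (auto simp: l_coset_def)
  then have "g \<otimes> h \<in> H #> g" using coset_eq assms(2) by simp
  then obtain k where k: "k \<in> H" "g \<otimes> h = k \<otimes> g" by (auto simp: r_coset_def)
  have "y = (inv h \<otimes> k) \<otimes> g" unfolding y using h k assms(2) by (simp add: m_assoc)
  then show "y \<in> H #> g" using h k by (auto simp: r_coset_def)
qed

text \<open>If conjugating \<open>g\<close> by \<open>y\<close> has the same effect as conjugating it by \<open>h \<in> H\<close>, then \<open>yh\<^sup>-\<^sup>1\<close>
  centralizes \<open>g\<close> and lies in \<open>yH = Hy\<close>.\<close>

lemma centralizer_meets_coset_if_non_split:
  assumes N: "H \<lhd> G" and g: "g \<in> carrier G" and y: "y \<in> carrier G"
    and ns: "conj_class g = conjugates_by G H g"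
  shows "centralizer g \<inter> (H #> y) \<noteq> {}"
proof -
  interpret normal H G by fact
  have "inv y \<otimes> g \<otimes> y \<in> conjugates_by G H g" using ns y by (blast intro: conjugates_byI)
  then obtain h where h: "h \<in> H" "inv y \<otimes> g \<otimes> y = inv h \<otimes> g \<otimes> h" by (rule conjugates_byE)
  have "y \<otimes> inv h \<in> centralizer g" using h g y by (simp add: conj_eq_iff_centralizer)
  moreover have "y \<otimes> inv h \<in> y <# H" using h by (auto simp: l_coset_def)
  ultimately show ?thesis using coset_eq y by auto
qed

text \<open>A centralizing representative of \<open>Ht\<close> yields, by taking its powers, centralizing representatives
  of all cosets. So every element of \<open>G\<close> has the form \<open>ch\<close> with \<open>c\<close> centralizing \<open>g\<close> and \<open>h \<in> H\<close>,
  and conjugating \<open>g\<close> by \<open>ch\<close> is the same as conjugating it by \<open>h\<close>.\<close>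

lemma non_split_if_centralizer_meets_generator:
  assumes N: "H \<lhd> G" and t: "t \<in> carrier G"
    and gen: "generate (G Mod H) {H #> t} = carrier (G Mod H)"
    and g: "g \<in> carrier G" and meet: "centralizer g \<inter> (H #> t) \<noteq> {}"
  shows "conj_class g = conjugates_by G H g"
proof
  interpret normal H G by fact
  have Z: "subgroup (centralizer g) G" using g by (rule subgroup_centralizer)
  obtain s where s: "s \<in> centralizer g" "s \<in> H #> t" using meet by blast
  have Hs: "H #> t = H #> s" using s(2) t subgroup_axioms by (rule repr_independence)
  have cover: "\<exists>c \<in> centralizer g. Q = H #> c" if "Q \<in> generate (G Mod H) {H #> t}" for Q
    using that
  proof (induction rule: generate.induct)
    case one
    then show ?case using Z subgroup.one_closed[OF Z] coset_mult_one[OF subset]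
      by (intro bexI[of _ \<one>]) auto
  next
    case (incl Q)
    then show ?case using Hs s by auto
  next
    case (inv Q)
    have "H #> s \<in> carrier (G Mod H)" using s(1) centralizer_closed by (auto simp: carrier_FactGroup)
    then have "inv\<^bsub>G Mod H\<^esub> Q = H #> inv s"
      using inv Hs s(1) centralizer_closed by (simp add: inv_FactGroup rcos_inv)
    then show ?case using s(1) subgroup.m_inv_closed[OF Z] by blast
  next
    case (eng P Q)
    then obtain c d where "c \<in> centralizer g" "P = H #> c" "d \<in> centralizer g" "Q = H #> d" by blast
    then show ?case using subgroup.m_closed[OF Z] centralizer_closed by (auto simp: rcos_sum)
  qed
  show "conj_class g \<subseteq> conjugates_by G H g"
  proof
    fix y assume "y \<in> conj_class g"
    then obtain k where k: "k \<in> carrier G" "y = inv k \<otimes> g \<otimes> k" by (rule conjugates_byE)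
    have "H #> k \<in> carrier (G Mod H)" using k by (auto simp: carrier_FactGroup)
    then obtain c where c: "c \<in> centralizer g" "H #> k = H #> c" using cover gen by blast
    have "k \<in> H #> c" using k(1) c(2) rcos_self[OF _ subgroup_axioms] by blast
    then have "k \<in> c <# H" using coset_eq c(1) centralizer_closed by auto
    then obtain h where h: "h \<in> H" "k = c \<otimes> h" by (auto simp: l_coset_def)
    then have "y = inv h \<otimes> g \<otimes> h" using k c g by (simp add: centralizer_mult_conj)
    then show "y \<in> conjugates_by G H g" using h by (auto intro: conjugates_byI)
  qed
  show "conjugates_by G H g \<subseteq> conj_class g"
    by (auto elim!: conjugates_byE intro!: conjugates_byI)
qed

section \<open>Counting commuting pairs\<close>

text \<open>A double sum of indicators rather than the cardinality of a set of pairs, so that symmetry and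
  additivity come from the sum lemmas.\<close>

definition commuting_pairs :: "'a set \<Rightarrow> 'a set \<Rightarrow> nat"
  where "commuting_pairs S T = (\<Sum>s\<in>S. \<Sum>u\<in>T. of_bool (s \<otimes> u = u \<otimes> s))"

lemma commuting_pairs_commute: "commuting_pairs S T = commuting_pairs T S"
  unfolding commuting_pairs_def by (subst sum.swap) (simp add: eq_commute)

lemma commuting_pairs_Union:
  assumes "\<And>T. T \<in> \<T> \<Longrightarrow> finite T" "pairwise disjnt \<T>"
  shows "commuting_pairs S (\<Union>\<T>) = (\<Sum>T\<in>\<T>. commuting_pairs S T)"
proof -
  have "(\<Sum>u\<in>\<Union>\<T>. of_bool (s \<otimes> u = u \<otimes> s)) = (\<Sum>T\<in>\<T>. \<Sum>u\<in>T. of_bool (s \<otimes> u = u \<otimes> s) :: nat)" for s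
    using assms by (subst sum.Union_disjoint) (auto simp: pairwise_def disjnt_def)
  then show ?thesis unfolding commuting_pairs_def by (simp add: sum.swap[of _ S])
qed

text \<open>Each \<open>c \<in> C\<close> commutes with \<open>card (H \<inter> C\<^sub>G(c))\<close> elements of the coset, which is
  \<open>card H / card C\<close> because \<open>C = c\<^sup>H\<close>. To avoid division, the proof works with \<open>card C\<close> times the
  count.\<close>

lemma commuting_pairs_class_coset:
  assumes fin: "finite (carrier G)" and N: "H \<lhd> G"
    and C: "C \<in> conjugacy_classes G" and y: "y \<in> carrier G"
    and ns: "\<And>c. c \<in> C \<Longrightarrow> conj_class c = conjugates_by G H c"
  shows "commuting_pairs C (H #> y) = card H"
proof -
  interpret normal H G by fact
  obtain c0 where c0: "c0 \<in> C" using C by (rule conjugacy_class_nonempty)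
  have CG: "C \<subseteq> carrier G" using conjugacy_class_of_member(1)[OF C] by blast
  have finC: "finite C" and finy: "finite (H #> y)"
    using fin CG r_coset_subset_G[OF subset y] by (auto intro: finite_subset)
  have row: "card C * (\<Sum>u\<in>H #> y. of_bool (c \<otimes> u = u \<otimes> c)) = card H" if c: "c \<in> C" for c
  proof -
    have cG: "c \<in> carrier G" using c CG by blast
    have "(\<Sum>u\<in>H #> y. of_bool (c \<otimes> u = u \<otimes> c)) = card ((H #> y) \<inter> {u. c \<otimes> u = u \<otimes> c})"
      using finy by simp
    also have "(H #> y) \<inter> {u. c \<otimes> u = u \<otimes> c} = centralizer c \<inter> (H #> y)"
      using r_coset_subset_G[OF subset y] by (auto simp: centralizer_def)
    also have "card \<dots> = card (H \<inter> centralizer c)"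
      using centralizer_meets_coset_if_non_split[OF N cG y ns[OF c]]
      by (intro card_subgroup_inter_coset subgroup_axioms subgroup_centralizer cG y)
    finally show ?thesis
      using orbit_size[OF fin subgroup_axioms cG] ns[OF c] conjugacy_class_of_member(2)[OF C c] by simp
  qed
  have "card C * commuting_pairs C (H #> y) = card C * card H"
    using row unfolding commuting_pairs_def by (simp add: sum_distrib_left)
  moreover have "card C > 0" using finC c0 by (auto simp: card_gt_0_iff)
  ultimately show ?thesis by simp
qed

lemma disjoint_conjugacy_classes: "pairwise disjnt (conjugacy_classes G)"
  by (auto simp: pairwise_def disjnt_def dest: conjugacy_class_of_member(2))

end

section \<open>The matching\<close>

theorem theorem1:
  fixes G (structure) and H :: "'a set" and t x :: 'a
  assumes "group G" and "finite (carrier G)"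
    and "H \<lhd> G" and "cyclic_group (G Mod H)"
    and "t \<in> carrier G" and "generate (G Mod H) {H #> t} = carrier (G Mod H)"
    and "x \<in> carrier G"
  shows "\<exists>f. bij_betw f
        {C \<in> conjugacy_classes G. non_split G H C \<and> C \<subseteq> H #> x}
        {D \<in> conjugacy_classes G. D \<subseteq> H #> t} \<and>
      (\<forall>C \<in> conjugacy_classes G. non_split G H C \<and> C \<subseteq> H #> x \<longrightarrow>
        classes_commute G C (f C))"
proof -
  interpret group G by fact
  interpret normal H G by fact
  let ?A = "{C \<in> conjugacy_classes G. non_split G H C \<and> C \<subseteq> H #> x}"
  let ?B = "{D \<in> conjugacy_classes G. D \<subseteq> H #> t}"
  note fin = assms(2) and N = assms(3) and t = assms(5) and gen = assms(6) and x = assms(7)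
  have class_in_coset: "conj_class g \<subseteq> H #> y"
    if "g \<in> H #> y" "y \<in> carrier G" "g \<in> carrier G" "conj_class g = conjugates_by G H g" for g y
    using that conj_by_subset_coset[OF N, of g] repr_independence[OF _ _ subgroup_axioms, of g y]
    by simp
  have coset_closed: "z \<in> carrier G" if "z \<in> H #> y" "y \<in> carrier G" for z y
    using that r_coset_subset_G[OF subset] by blast
  have meet_t: "conj_class g = conjugates_by G H g"
    if "g \<in> carrier G" "u \<in> H #> t" "g \<otimes> u = u \<otimes> g" for g u
  proof (rule non_split_if_centralizer_meets_generator[OF N t gen that(1)])
    have "u \<in> centralizer g" using that coset_closed[OF _ t] by (simp add: centralizer_def)
    then show "centralizer g \<inter> (H #> t) \<noteq> {}" using that(2) by blast
  qed
  have nsA: "conj_class c = conjugates_by G H c" if "C \<in> ?A" "c \<in> C" for C c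
    using that conjugacy_class_of_member[of C c] non_split_conjugates_by_iff[OF N, of c] by simp
  have nsB: "conj_class d = conjugates_by G H d" if "d \<in> H #> t" for d
    using that coset_closed[OF that t] by (intro meet_t) auto
  have UB: "\<Union>?B = H #> t"
  proof (intro equalityI subsetI)
    fix d assume d: "d \<in> H #> t"
    then have dG: "d \<in> carrier G" using coset_closed t by blast
    then have "conj_class d \<in> ?B"
      using class_in_coset[OF d t dG nsB[OF d]] by (auto simp: conjugacy_classes_def)
    then show "d \<in> \<Union>?B" using self_in_class[OF dG] by blast
  qed auto
  have UA: "\<Union>?A = {c \<in> H #> x. conj_class c = conjugates_by G H c}"
  proof (intro equalityI subsetI)
    fix c assume "c \<in> {c \<in> H #> x. conj_class c = conjugates_by G H c}"
    then have c: "c \<in> H #> x" "conj_class c = conjugates_by G H c" by auto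
    then have cG: "c \<in> carrier G" using coset_closed x by blast
    then have "conj_class c \<in> ?A"
      using class_in_coset[OF c(1) x cG c(2)] c(2) by (auto simp: conjugacy_classes_def non_split_def)
    then show "c \<in> \<Union>?A" using self_in_class[OF cG] by blast
  qed (use nsA in auto)
  have fin_class: "finite C" if "C \<in> conjugacy_classes G" for C
    using conjugacy_class_of_member(1)[OF that] fin by (meson finite_subset subsetI)
  have "finite (conjugacy_classes G)"
    using fin by (simp add: conjugacy_classes_def Setcompr_eq_image)
  then have finAB: "finite ?A" "finite ?B" by auto
  have disj: "pairwise disjnt ?A" "pairwise disjnt ?B"
    using disjoint_conjugacy_classes by (auto simp: pairwise_def disjnt_def)
  have "\<exists>f. bij_betw f ?A ?B \<and> (\<forall>C \<in> ?A. commuting_pairs C (f C) > 0)"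
  proof (rule bij_betw_of_constant_marginals[OF finAB])
    show "card H > 0"
      using fin subset subgroup.one_closed[OF subgroup_axioms]
      by (metis card_gt_0_iff empty_iff finite_subset)
    show "(\<Sum>D\<in>?B. commuting_pairs C D) = card H" if C: "C \<in> ?A" for C
    proof -
      have "(\<Sum>D\<in>?B. commuting_pairs C D) = commuting_pairs C (\<Union>?B)"
        using fin_class disj(2) by (intro commuting_pairs_Union[symmetric]) auto
      also have "\<dots> = card H"
        unfolding UB using C by (intro commuting_pairs_class_coset[OF fin N _ t nsA[OF C]]) auto
      finally show ?thesis .
    qed
    show "(\<Sum>C\<in>?A. commuting_pairs C D) = card H" if D: "D \<in> ?B" for D
    proof -
      have DG: "D \<in> conjugacy_classes G" and Dt: "D \<subseteq> H #> t" using D by auto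
      have "(\<Sum>C\<in>?A. commuting_pairs C D) = (\<Sum>C\<in>?A. commuting_pairs D C)"
        by (intro sum.cong refl commuting_pairs_commute)
      also have "\<dots> = commuting_pairs D (\<Union>?A)"
        using fin_class disj(1) by (intro commuting_pairs_Union[symmetric]) auto
      also have "\<dots> = commuting_pairs D (H #> x)"
        \<comment> \<open>Elements of split classes in \<open>H #> x\<close> commute with nothing in \<open>D \<subseteq> H #> t\<close>.\<close>
        unfolding commuting_pairs_def UA
      proof (rule sum.cong[OF refl], rule sum.mono_neutral_left)
        show "finite (H #> x)" using fin r_coset_subset_G[OF subset x] by (rule rev_finite_subset)
        show "\<forall>c \<in> (H #> x) - {c \<in> H #> x. conj_class c = conjugates_by G H c}.
                (of_bool (d \<otimes> c = c \<otimes> d) :: nat) = 0" if "d \<in> D" for d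
          using that Dt meet_t[of _ d] coset_closed[OF _ x] by (auto simp: of_bool_def)
      qed auto
      also have "\<dots> = card H"
        using Dt nsB by (intro commuting_pairs_class_coset[OF fin N DG x]) auto
      finally show ?thesis .
    qed
  qed
  moreover have "classes_commute G C D" if "commuting_pairs C D > 0" for C D
  proof (rule ccontr)
    assume "\<not> classes_commute G C D"
    then have "commuting_pairs C D = 0"
      by (auto simp: commuting_pairs_def classes_commute_def intro!: sum.neutral)
    then show False using that by simp
  qed
  ultimately show ?thesis by blast
qed

end
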